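(* Let $p$ be a prime and let $n \geq 0$ be an integer. There is a bijection between the set $N_\infty(C_{p^n})$, ordered by inclusion of the corresponding sets of norm maps, and the set of rooted binary trees with $n+2$ leaves, ordered by clockwise tree rotations (i.e. the poset $\mathcal{A}_{n+1}$), and this bijection is both order-preserving and order-reflecting. That is, the posets $N_\infty(C_{p^n})$ and $\mathcal{A}_{n+1}$ are isomorphic.
   Context: $N_\infty(G)$ denotes the set of homotopy classes of $N_\infty$-operads for a finite group $G$. For $G = C_{p^n}$ its elements are identified with transfer systems, described by sets of norm maps as follows. An element $X \in N_\infty(C_{p^n})$ is a set of symbols $N_i^j$ with $0 \leq i < j \leq n$ (the symbol $N_i^j$ stands for a norm map from the subgroup $C_{p^i}$ to the subgroup $C_{p^j}$; the identity norms $N_i^i$ are regarded as always present and are not written) such that: (Restriction) if $N_i^j \in X$ and $i < k < j$, then $N_i^k \in X$; (Composition) if $N_i^j \in X$ and $N_j^k \in X$, then $N_i^k \in X$. The partial order on $N_\infty(C_{p^n})$ is: $X \leq Y$ if and only if $X \subseteq Y$ as sets of norm maps. A rooted binary tree is a plane rooted tree in which each internal vertex has exactly two ordered children (left and right). A clockwise tree rotation replaces, at any place in the tree, a subtree of the form $((A,B),C)$ by $(A,(B,C))$, where $(S,T)$ denotes the tree whose root has left subtree $S$ and right subtree $T$, and $A,B,C$ are arbitrary (possibly one-leaf) binary trees. For binary trees $S,T$ with the same number of leaves, $S \leq T$ if $T$ is obtained from $S$ by a finite (possibly empty) sequence of clockwise rotations. The set of rooted binary trees with $m+1$ leaves with this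 partial order is the poset $\mathcal{A}_m$ (the $m$-associahedron, or $m$-Tamari lattice). *)

theory Defs
  imports Complex_Main "HOL-Computational_Algebra.Primes" "HOL-Library.Tree"
begin

text \<open>The pair (i, j) encodes the norm symbol \<open>N_i^j\<close>, a norm map from the subgroup of order
  \<open>p^i\<close> to the subgroup of order \<open>p^j\<close> of the cyclic group of order \<open>p^n\<close>. Identity norms
  \<open>N_i^i\<close> are implicitly present and not recorded. This combinatorial
  description of the homotopy classes of \<open>N_\<infinity>\<close>-operads does not involve the
  prime p; order is inclusion of sets.\<close>

type_synonym norm_map = "nat \<times> nat"

definition N_infty :: "nat \<Rightarrow> norm_map set set" where
  "N_infty n = {X.
     (\<forall>(i, j) \<in> X. i < j \<and> j \<le> n) \<and>
     (\<forall>i j k. (i, j) \<in> X \<longrightarrow> i < k \<longrightarrow> k < j \<longrightarrow> (i, k) \<in> X) \<and>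
     (\<forall>i j k. (i, j) \<in> X \<longrightarrow> (j, k) \<in> X \<longrightarrow> (i, k) \<in> X)}"

text \<open>Unlabelled plane binary trees are trees with labels in the one-element type;
  \<^const>\<open>size1\<close> is the number of leaves.\<close>

type_synonym binary_tree = "unit tree"

inductive clockwise_rotation :: "binary_tree \<Rightarrow> binary_tree \<Rightarrow> bool" where
  root: "clockwise_rotation \<langle>\<langle>A, (), B\<rangle>, (), C\<rangle> \<langle>A, (), \<langle>B, (), C\<rangle>\<rangle>"
| left: "clockwise_rotation S S' \<Longrightarrow> clockwise_rotation \<langle>S, (), T\<rangle> \<langle>S', (), T\<rangle>"
| right: "clockwise_rotation T T' \<Longrightarrow> clockwise_rotation \<langle>S, (), T\<rangle> \<langle>S, (), T'\<rangle>"

definition tamari_le :: "binary_tree \<Rightarrow> binary_tree \<Rightarrow> bool" where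
  "tamari_le = clockwise_rotation\<^sup>*\<^sup>*"

definition associahedron :: "nat \<Rightarrow> binary_tree set" where
  "associahedron m = {t. size1 t = m + 1}"

end

theory Submission
  imports Defs
begin

text \<open>Number the internal vertices of a tree in symmetric order and record, for each of them, the
  size of its right subtree. This bracket vector \<open>v\<close> (Huang and Tamari) turns the rotation order
  into the componentwise order. On the other side, restriction says that the targets of the norm
  maps out of \<open>i\<close> form an interval \<open>i < j \<le> i + v ! i\<close>, and composition is then exactly the
  nesting condition which characterises bracket vectors.

  For the reflection of the order, let \<open>S\<close> have a vector below that of \<open>T\<close>, and let \<open>c\<close> be the
  number of the root of \<open>T\<close>. No interval of \<open>S\<close> starting to the left of \<open>c\<close> reaches \<open>c\<close>, so
  \<open>c\<close> lies on the left spine of \<open>S\<close> and can be rotated up to the root; all other entries of the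
  vector are unchanged by this, and one recurses into both subtrees.\<close>

fun bracket_vector :: "'a tree \<Rightarrow> nat list" where
  "bracket_vector \<langle>\<rangle> = []"
| "bracket_vector \<langle>l, a, r\<rangle> = bracket_vector l @ size r # bracket_vector r"

text \<open>Entry \<open>i\<close> stands for the interval from \<open>i\<close> to
  \<open>i + v ! i\<close>; for a tree it consists of vertex \<open>i\<close> and its right
  subtree.\<close>

definition nested :: "nat list \<Rightarrow> bool" where
  "nested v \<longleftrightarrow> (\<forall>i < length v. i + v ! i < length v \<and>
     (\<forall>j. i < j \<longrightarrow> j \<le> i + v ! i \<longrightarrow> j + v ! j \<le> i + v ! i))"

definition norms :: "nat list \<Rightarrow> norm_map set" where
  "norms v = {(i, j). i < length v \<and> i < j \<and> j \<le> i + v ! i}"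

lemma length_bracket_vector [simp]: "length (bracket_vector t) = size t"
  by (induction t) auto

section \<open>Bracket vectors\<close>

lemma nested_bound: "nested v \<Longrightarrow> i < length v \<Longrightarrow> i + v ! i < length v"
  by (simp add: nested_def)

lemma nestedD:
  "nested v \<Longrightarrow> i < j \<Longrightarrow> j \<le> i + v ! i \<Longrightarrow> i < length v \<Longrightarrow> j + v ! j \<le> i + v ! i"
  by (simp add: nested_def)

text \<open>The middle entry reaches exactly to the end, so it encloses every interval of
  \<open>w\<close>, while the intervals of \<open>u\<close> stop before it.\<close>

lemma nested_join:
  assumes u: "nested u" and w: "nested w"
  shows "nested (u @ length w # w)"
  unfolding nested_def
proof (intro allI impI conjI)
  let ?v = "u @ length w # w"
  fix i assume i: "i < length ?v"
  consider "i < length u" | "i = length u" | k where "i = Suc (length u + k)" "k < length w"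
  proof -
    have "i = Suc (length u + (i - Suc (length u)))" "i - Suc (length u) < length w"
      if "length u < i" using that i by simp_all
    then show ?thesis using that by (meson linorder_neqE_nat)
  qed
  note cases = this
  show bound: "i + ?v ! i < length ?v"
    using cases
  proof cases
    case 1
    then show ?thesis using nested_bound[OF u 1] by (simp add: nth_append)
  next
    case (3 k)
    then show ?thesis using nested_bound[OF w 3(2)] by (simp add: nth_append)
  qed simp
  fix j assume j: "i < j" "j \<le> i + ?v ! i"
  show "j + ?v ! j \<le> i + ?v ! i"
    using cases
  proof cases
    case 1
    then show ?thesis
      using nested_bound[OF u 1] nestedD[OF u j(1) _ 1] j by (simp add: nth_append)
  next
    case 2
    define k where "k = j - Suc (length u)"
    have "j = Suc (length u + k)" "k < length w"
      using 2 j by (simp_all add: k_def)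
    then show ?thesis using nested_bound[OF w, of k] 2 by (simp add: nth_append)
  next
    case (3 k)
    define l where "l = j - Suc (length u)"
    have "j = Suc (length u + l)" using 3 j by (simp add: l_def)
    then show ?thesis using nestedD[OF w, of k l] 3 j by (simp add: nth_append)
  qed
qed

lemma nested_bracket_vector: "nested (bracket_vector t)"
proof (induction t)
  case Leaf
  show ?case by (simp add: nested_def)
next
  case (Node l a r)
  then show ?case using nested_join[of "bracket_vector l" "bracket_vector r"] by simp
qed

text \<open>Inverse of \<open>nested_join\<close>, used to read a tree off a vector: the root is
  taken to be the first index whose interval reaches the end.\<close>

lemma nested_split:
  assumes v: "nested v" "v \<noteq> []"
  obtains u w where "v = u @ length w # w" "nested u" "nested w"
proof -
  define m where "m = length v"
  define c where "c = (LEAST i. i < m \<and> i + v ! i = m - 1)"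
  have m: "m > 0" using v by (simp add: m_def)
  \<comment> \<open>The last index qualifies, its entry being 0, so the minimum is attained.\<close>
  have "m - 1 + v ! (m - 1) < m"
    using nested_bound[OF v(1), of "m - 1"] m by (simp add: m_def)
  then have "m - 1 < m \<and> (m - 1) + v ! (m - 1) = m - 1" using m by simp
  then have c: "c < m \<and> c + v ! c = m - 1" unfolding c_def by (rule LeastI)
  have least: "c \<le> i" if "i < m" "i + v ! i = m - 1" for i
    unfolding c_def using that by (intro Least_le) simp
  \<comment> \<open>An earlier interval reaching \<open>c\<close> would by nesting also reach the
    end, against the minimality of \<open>c\<close>.\<close>
  have below: "i + v ! i < c" if "i < c" for i
  proof (rule ccontr)
    assume "\<not> i + v ! i < c"
    then have "c + v ! c \<le> i + v ! i"
      using nestedD[OF v(1) that] that c by (simp add: m_def)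
    moreover have "i + v ! i < m"
      using nested_bound[OF v(1), of i] that c by (simp add: m_def)
    ultimately have "i + v ! i = m - 1" using c by linarith
    with least[of i] that c show False by simp
  qed
  let ?u = "take c v" and ?w = "drop (Suc c) v"
  have "v = ?u @ v ! c # ?w" using c by (simp add: m_def id_take_nth_drop)
  moreover have "v ! c = length ?w" using c by (simp add: m_def) linarith
  ultimately have split: "v = ?u @ length ?w # ?w" by metis
  have "nested ?u"
    unfolding nested_def
  proof (intro allI impI conjI)
    fix i assume "i < length ?u"
    then have i: "i < c" by simp
    show "i + ?u ! i < length ?u" using below[OF i] i c by (simp add: m_def)
    fix j assume j: "i < j" "j \<le> i + ?u ! i"
    then show "j + ?u ! j \<le> i + ?u ! i"
      using nestedD[OF v(1) j(1)] below[OF i] i c by (simp add: m_def)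
  qed
  moreover have "nested ?w"
    unfolding nested_def
  proof (intro allI impI conjI)
    fix i assume "i < length ?w"
    then have i: "Suc c + i < length v" by simp
    show "i + ?w ! i < length ?w" using nested_bound[OF v(1) i] i by simp
    fix j assume j: "i < j" "j \<le> i + ?w ! i"
    then show "j + ?w ! j \<le> i + ?w ! i"
      using nestedD[OF v(1), of "Suc c + i" "Suc c + j"] i by simp
  qed
  ultimately show ?thesis using that split by blast
qed

lemma nested_imp_bracket_vector:
  assumes "nested v"
  shows "\<exists>t :: unit tree. bracket_vector t = v"
  using assms
proof (induction v rule: length_induct)
  case (1 v)
  show ?case
  proof (cases "v = []")
    case True
    then show ?thesis by (intro exI[of _ Leaf]) simp
  next
    case False
    with 1 obtain u w where v: "v = u @ length w # w" "nested u" "nested w"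
      using nested_split by blast
    obtain l :: "unit tree" where l: "bracket_vector l = u"
      using 1 v(1,2) by (metis length_append less_add_same_cancel1
          length_greater_0_conv list.discI)
    obtain r :: "unit tree" where r: "bracket_vector r = w"
      using 1 v(1,3) by (metis length_append length_Cons less_Suc_eq_le
          le_add2 add_Suc_right)
    show ?thesis
      using l r v(1) by (intro exI[of _ "Node l () r"]) (auto simp flip: length_bracket_vector)
  qed
qed

text \<open>The root is the first vertex whose interval reaches the end of the vector.\<close>

lemma bracket_vector_root_le:
  assumes "list_all2 (\<le>) (bracket_vector \<langle>A, a, B\<rangle>) (bracket_vector \<langle>C, c, D\<rangle>)"
  shows "size C \<le> size A"
proof (rule ccontr)
  assume less: "\<not> size C \<le> size A"
  have sz: "size A + size B = size C + size D"
    using list_all2_lengthD[OF assms] by simp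
  \<comment> \<open>Compare at \<open>size A\<close>, the root of the first tree: there its interval
    ends at the last index, whereas in the second tree this vertex lies in \<open>C\<close>, whose
    intervals end before \<open>size C\<close>.\<close>
  have "bracket_vector \<langle>A, a, B\<rangle> ! size A \<le> bracket_vector \<langle>C, c, D\<rangle> ! size A"
    using list_all2_nthD[OF assms, of "size A"] by simp
  then have "size B \<le> bracket_vector C ! size A"
    using less by (simp add: nth_append)
  moreover have "size A + bracket_vector C ! size A < size C"
    using nested_bound[OF nested_bracket_vector, of "size A" C] less by simp
  ultimately show False using sz by linarith
qed

text \<open>Comparing roots in both directions makes the left subtrees equally large, so equal
  vectors split at the same place.\<close>

lemma bracket_vector_inject:
  fixes S T :: "unit tree"
  assumes "bracket_vector S = bracket_vector T"
  shows "S = T"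
  using assms
proof (induction S arbitrary: T)
  case Leaf
  then show ?case by (cases T) auto
next
  case (Node A a B)
  then obtain C c D where T: "T = \<langle>C, c, D\<rangle>" by (cases T) auto
  have eq: "bracket_vector \<langle>A, a, B\<rangle> = bracket_vector \<langle>C, c, D\<rangle>"
    using Node.prems T by simp
  have "list_all2 (\<le>) v v" for v :: "nat list" by (simp add: list.rel_refl)
  then have "size A = size C"
    using bracket_vector_root_le[of A a B C c D] bracket_vector_root_le[of C c D A a B] eq
    by (metis le_antisym)
  then show ?case using eq T Node.IH by simp
qed

section \<open>The rotation order\<close>

text \<open>A rotation at the root raises one entry, from \<open>size B\<close> to
  \<open>size B + size C + 1\<close>, and keeps the others. Equality of sizes is carried along
  because a rotation in a right subtree must preserve the entry of the vertex above it.\<close>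

lemma rotation_bracket_vector:
  "clockwise_rotation S T \<Longrightarrow>
    size S = size T \<and> list_all2 (\<le>) (bracket_vector S) (bracket_vector T)"
  by (induction rule: clockwise_rotation.induct)
    (auto intro!: list_all2_appendI list_all2_refl)

lemma tamari_le_bracket_vector:
  assumes "tamari_le S T"
  shows "list_all2 (\<le>) (bracket_vector S) (bracket_vector T)"
  using assms unfolding tamari_le_def
proof (induction rule: rtranclp_induct)
  case base
  show ?case by (simp add: list.rel_refl)
next
  case (step T U)
  then show ?case
    using rotation_bracket_vector[of T U] by (auto elim: list_all2_trans[rotated])
qed

lemma tamari_le_trans: "tamari_le S T \<Longrightarrow> tamari_le T U \<Longrightarrow> tamari_le S U"
  by (simp add: tamari_le_def)

lemma tamari_le_left: "tamari_le S S' \<Longrightarrow> tamari_le \<langle>S, (), T\<rangle> \<langle>S', (), T\<rangle>"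
  unfolding tamari_le_def
  by (induction rule: rtranclp_induct) (auto intro: rtranclp.rtrancl_into_rtrancl left)

lemma tamari_le_right: "tamari_le T T' \<Longrightarrow> tamari_le \<langle>S, (), T\<rangle> \<langle>S, (), T'\<rangle>"
  unfolding tamari_le_def
  by (induction rule: rtranclp_induct) (auto intro: rtranclp.rtrancl_into_rtrancl right)

text \<open>By hypothesis no earlier vertex has \<open>c\<close> in its right subtree, so
  \<open>c\<close> is on the left spine. Each rotation lifting \<open>c\<close> changes only entry
  \<open>c\<close>, so the entries on either side survive.\<close>

lemma rotate_to_root:
  assumes "c < size S" and "\<And>i. i < c \<Longrightarrow> i + bracket_vector S ! i < c"
  shows "\<exists>P Q. tamari_le S \<langle>P, (), Q\<rangle> \<and> bracket_vector P = take c (bracket_vector S) \<and>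
    bracket_vector Q = drop (Suc c) (bracket_vector S)"
  using assms
proof (induction S)
  case (Node A a B)
  consider "c = size A" | "size A < c" | "c < size A" by linarith
  then show ?case
  proof cases
    case 1
    then show ?thesis by (intro exI[of _ A] exI[of _ B]) (simp add: tamari_le_def)
  next
    case 2
    \<comment> \<open>Impossible: the interval of the root \<open>size A\<close> would contain
      \<open>c\<close>.\<close>
    then show ?thesis using Node.prems(2)[OF 2] Node.prems(1) by (simp add: nth_append)
  next
    case 3
    have "i + bracket_vector A ! i < c" if "i < c" for i
      using Node.prems(2)[OF that] that 3 by (simp add: nth_append)
    with Node.IH(1) 3 obtain P Q where PQ: "tamari_le A \<langle>P, (), Q\<rangle>"
      "bracket_vector P = take c (bracket_vector A)"
      "bracket_vector Q = drop (Suc c) (bracket_vector A)" by blast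
    have "tamari_le \<langle>A, (), B\<rangle> \<langle>\<langle>P, (), Q\<rangle>, (), B\<rangle>" using PQ(1) by (rule tamari_le_left)
    moreover have "tamari_le \<langle>\<langle>P, (), Q\<rangle>, (), B\<rangle> \<langle>P, (), \<langle>Q, (), B\<rangle>\<rangle>"
      unfolding tamari_le_def by (intro r_into_rtranclp root)
    ultimately have "tamari_le \<langle>A, (), B\<rangle> \<langle>P, (), \<langle>Q, (), B\<rangle>\<rangle>" by (rule tamari_le_trans)
    then show ?thesis
      using PQ 3 by (intro exI[of _ P] exI[of _ "\<langle>Q, (), B\<rangle>"]) simp
  qed
qed simp

lemma bracket_vector_le_imp_tamari_le:
  assumes "list_all2 (\<le>) (bracket_vector S) (bracket_vector T)"
  shows "tamari_le S T"
  using assms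
proof (induction T arbitrary: S)
  case Leaf
  then show ?case by (cases S) (auto simp: tamari_le_def)
next
  case (Node C a D)
  let ?s = "bracket_vector S" and ?t = "bracket_vector \<langle>C, a, D\<rangle>" and ?c = "size C"
  have sz: "size S = Suc (size C + size D)"
    using list_all2_lengthD[OF Node.prems] by simp
  \<comment> \<open>The target tree has only vertices of \<open>C\<close> before its root, and their
    intervals end before \<open>?c\<close>; those of \<open>S\<close> are no longer.\<close>
  have "i + ?s ! i < ?c" if "i < ?c" for i
  proof -
    have "?s ! i \<le> ?t ! i" using list_all2_nthD[OF Node.prems] that sz by simp
    moreover have "i + bracket_vector C ! i < ?c"
      using nested_bound[OF nested_bracket_vector, of i C] that by simp
    ultimately show ?thesis using that by (simp add: nth_append)
  qed
  with rotate_to_root[of ?c S] sz obtain P Q where PQ: "tamari_le S \<langle>P, (), Q\<rangle>"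
    "bracket_vector P = take ?c ?s" "bracket_vector Q = drop (Suc ?c) ?s" by auto
  have "list_all2 (\<le>) (take ?c ?s) (take ?c ?t)"
    "list_all2 (\<le>) (drop (Suc ?c) ?s) (drop (Suc ?c) ?t)"
    using Node.prems by (auto simp only: list_all2_takeI list_all2_dropI)
  then have "tamari_le P C" "tamari_le Q D" using PQ Node.IH by simp_all
  then have "tamari_le \<langle>P, (), Q\<rangle> \<langle>C, (), D\<rangle>"
    by (rule tamari_le_trans[OF tamari_le_left tamari_le_right])
  with PQ(1) show ?case by (simp add: tamari_le_trans)
qed

lemma tamari_le_iff: "tamari_le S T \<longleftrightarrow> list_all2 (\<le>) (bracket_vector S) (bracket_vector T)"
  using tamari_le_bracket_vector bracket_vector_le_imp_tamari_le by blast

section \<open>Transfer systems\<close>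

text \<open>Inclusion is tested on the farthest target \<open>i + v ! i\<close>; for a zero entry
  the inequality is trivial.\<close>

lemma norms_subset_iff:
  assumes "length v = length w"
  shows "norms v \<subseteq> norms w \<longleftrightarrow> list_all2 (\<le>) v w"
proof
  assume sub: "norms v \<subseteq> norms w"
  have "v ! i \<le> w ! i" if "i < length v" for i
  proof (cases "v ! i = 0")
    case False
    then have "(i, i + v ! i) \<in> norms v" using that by (simp add: norms_def)
    with sub have "(i, i + v ! i) \<in> norms w" by blast
    then show ?thesis by (simp add: norms_def)
  qed simp
  then show "list_all2 (\<le>) v w" using assms by (simp add: list_all2_conv_all_nth)
next
  assume "list_all2 (\<le>) v w"
  then show "norms v \<subseteq> norms w"
    by (fastforce simp: list_all2_conv_all_nth norms_def)
qed

text \<open>Restriction is built into the intervals and composition is nesting; the n + 1 positions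
  are the exponents 0, ..., n.\<close>

lemma norms_in_N_infty:
  assumes "nested v" "length v = n + 1"
  shows "norms v \<in> N_infty n"
  unfolding N_infty_def
proof (intro CollectI conjI allI impI)
  show "\<forall>(i, j)\<in>norms v. i < j \<and> j \<le> n"
  proof clarify
    fix i j assume "(i, j) \<in> norms v"
    then show "i < j \<and> j \<le> n"
      using nested_bound[OF assms(1), of i] assms(2) by (simp add: norms_def)
  qed
next
  fix i j k assume "(i, j) \<in> norms v" "(j, k) \<in> norms v"
  then show "(i, k) \<in> norms v"
    using nestedD[OF assms(1), of i j] by (auto simp: norms_def)
qed (auto simp: norms_def)

text \<open>The vector counts the norm maps out of each \<open>i\<close>. Restriction makes their
  targets a gapless interval starting at \<open>i + 1\<close>, and composition yields
  nesting.\<close>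

lemma N_infty_norms:
  assumes "X \<in> N_infty n"
  obtains v where "nested v" "length v = n + 1" "X = norms v"
proof -
  have "\<forall>(i, j)\<in>X. i < j \<and> j \<le> n"
    and restr': "\<forall>i j k. (i, j) \<in> X \<longrightarrow> i < k \<longrightarrow> k < j \<longrightarrow> (i, k) \<in> X"
    and comp': "\<forall>i j k. (i, j) \<in> X \<longrightarrow> (j, k) \<in> X \<longrightarrow> (i, k) \<in> X"
    using assms unfolding N_infty_def by blast+
  then have bound: "i < j" "j \<le> n" if "(i, j) \<in> X" for i j
    using that by blast+
  have restr: "(i, k) \<in> X" if "(i, j) \<in> X" "i < k" "k \<le> j" for i j k
    using restr' that by (cases "k = j") (auto dest: le_neq_implies_less)
  have comp: "(i, k) \<in> X" if "(i, j) \<in> X" "(j, k) \<in> X" for i j k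
    using comp' that by blast
  define d where "d i = card {j. (i, j) \<in> X}" for i
  have targets: "{j. (i, j) \<in> X} = {i<..i + d i}" for i
  proof (cases "{j. (i, j) \<in> X} = {}")
    case False
    have fin: "finite {j. (i, j) \<in> X}"
      by (rule finite_subset[of _ "{..n}"]) (use bound(2) in blast, simp)
    define M where "M = Max {j. (i, j) \<in> X}"
    have "(i, M) \<in> X" using Max_in[OF fin False] by (simp add: M_def)
    moreover have "j \<le> M" if "(i, j) \<in> X" for j
      using Max_ge[OF fin] that by (simp add: M_def)
    ultimately have eq: "{j. (i, j) \<in> X} = {i<..M}"
      using bound(1) restr unfolding greaterThanAtMost_def greaterThan_def atMost_def by blast
    have "i < M" using \<open>(i, M) \<in> X\<close> by (rule bound(1))
    then show ?thesis by (simp add: d_def eq)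
  qed (simp add: d_def)
  have mem: "(i, j) \<in> X \<longleftrightarrow> i < j \<and> j \<le> i + d i" for i j
  proof -
    have "(i, j) \<in> X \<longleftrightarrow> j \<in> {i<..i + d i}" by (simp flip: targets)
    then show ?thesis by simp
  qed
  define v where "v = map d [0..<n + 1]"
  have len: "length v = n + 1" by (simp add: v_def)
  have nth: "v ! i = d i" if "i \<le> n" for i
    using that nth_map_upt[of i "n + 1" 0 d] by (simp add: v_def)
  have top: "i + d i \<le> n" if "i \<le> n" for i
    using bound(2)[of i "i + d i"] mem[of i "i + d i"] that by (cases "d i = 0") simp_all
  have "nested v"
    unfolding nested_def
  proof (intro allI impI conjI)
    fix i assume "i < length v"
    then have i: "i \<le> n" by (simp add: len)
    show "i + v ! i < length v" using top[OF i] i by (simp add: nth len)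
    fix j assume j: "i < j" "j \<le> i + v ! i"
    then have jn: "j \<le> n" using top[OF i] i by (simp add: nth)
    have ij: "(i, j) \<in> X" using i j by (simp add: mem nth)
    show "j + v ! j \<le> i + v ! i"
    \<comment> \<open>Compose the norm from \<open>i\<close> to \<open>j\<close> with the longest
      norm out of \<open>j\<close>; if \<open>d j = 0\<close> there is none, and the claim is the
      assumption on \<open>j\<close>.\<close>
    proof (cases "d j = 0")
      case False
      then have "(j, j + d j) \<in> X" by (simp add: mem)
      with ij have "(i, j + d j) \<in> X" by (rule comp)
      then show ?thesis using i jn by (simp add: mem nth)
    qed (use j i jn nth in simp)
  qed
  moreover have "X = norms v"
  proof -
    have "(i, j) \<in> X \<longleftrightarrow> (i, j) \<in> norms v" for i j
      using mem[of i j] bound[of i j] by (auto simp: norms_def len nth)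
    then show ?thesis by auto
  qed
  ultimately show ?thesis using that len by blast
qed

text \<open>Trees in \<open>associahedron (n + 1)\<close> have n + 2 leaves, hence n + 1 internal
  vertices, one per exponent 0, ..., n. For injectivity, equal norm sets compare the vectors both
  ways.\<close>

lemma bij_betw_norms_bracket_vector:
  "bij_betw (norms \<circ> bracket_vector) (associahedron (n + 1)) (N_infty n)"
proof (rule bij_betw_imageI)
  show "inj_on (norms \<circ> bracket_vector) (associahedron (n + 1))"
  proof (rule inj_onI)
    fix S T
    assume "S \<in> associahedron (n + 1)" "T \<in> associahedron (n + 1)"
      and eq: "(norms \<circ> bracket_vector) S = (norms \<circ> bracket_vector) T"
    then have len: "length (bracket_vector S) = length (bracket_vector T)"
      by (simp add: associahedron_def size1_size)
    have "list_all2 (\<le>) (bracket_vector S) (bracket_vector T)"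
      "list_all2 (\<le>) (bracket_vector T) (bracket_vector S)"
      using norms_subset_iff[OF len] norms_subset_iff[OF len[symmetric]] eq by simp_all
    then have "bracket_vector S = bracket_vector T"
      by (simp add: list_all2_antisym[of "(\<le>)" "(\<le>)"])
    then show "S = T" by (rule bracket_vector_inject)
  qed
  show "(norms \<circ> bracket_vector) ` associahedron (n + 1) = N_infty n"
  proof (intro equalityI subsetI)
    fix X assume "X \<in> N_infty n"
    then obtain v where v: "nested v" "length v = n + 1" "X = norms v" by (rule N_infty_norms)
    obtain t :: binary_tree where t: "bracket_vector t = v"
      using nested_imp_bracket_vector[OF v(1)] by blast
    then have "t \<in> associahedron (n + 1)"
      using v(2) by (auto simp: associahedron_def size1_size)
    then show "X \<in> (norms \<circ> bracket_vector) ` associahedron (n + 1)" using t v(3) by auto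
  qed (auto simp: associahedron_def size1_size intro!: norms_in_N_infty nested_bracket_vector)
qed

theorem theorem25:
  fixes p n :: nat
  assumes "prime p"
  shows "\<exists>f. bij_betw f (N_infty n) (associahedron (n + 1)) \<and>
    (\<forall>X \<in> N_infty n. \<forall>Y \<in> N_infty n. X \<subseteq> Y \<longleftrightarrow> tamari_le (f X) (f Y))"
proof -
  define g where "g = norms \<circ> (bracket_vector :: binary_tree \<Rightarrow> nat list)"
  \<comment> \<open>\<open>g\<close> leads from trees to norm sets; the opposite direction is
    wanted.\<close>
  define f where "f = inv_into (associahedron (n + 1)) g"
  have g: "bij_betw g (associahedron (n + 1)) (N_infty n)"
    unfolding g_def by (rule bij_betw_norms_bracket_vector)
  then have f: "bij_betw f (N_infty n) (associahedron (n + 1))"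
    unfolding f_def by (rule bij_betw_inv_into)
  have "X \<subseteq> Y \<longleftrightarrow> tamari_le (f X) (f Y)" if "X \<in> N_infty n" "Y \<in> N_infty n" for X Y
  proof -
    have "g (f X) = X" "g (f Y) = Y"
      using that g by (simp_all add: f_def bij_betw_inv_into_right)
    moreover have "length (bracket_vector (f X)) = length (bracket_vector (f Y))"
      using that bij_betwE[OF f] by (simp add: associahedron_def size1_size)
    \<comment> \<open>\<open>X\<close> and \<open>Y\<close> are the \<open>norms\<close> of the
      bracket vectors of \<open>f X\<close> and \<open>f Y\<close>, so both orders become the
      componentwise one.\<close>
    ultimately show ?thesis
      using norms_subset_iff by (metis tamari_le_iff g_def comp_apply)
  qed
  with f show ?thesis by blast
qed

end
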